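(* Let $\pi=(d_{\max},\ldots,d_{\max},d_{\max}-1,\ldots,d_{\max}-1,\ldots,1,\ldots,1)$ be a full graphic sequence with $n$ elements, all lying in $\{1,\ldots,d_{\max}\}$, such that $d_{\max}\leq n/4$, the sum of the elements of $\pi$ is at least $2n+d_{\max}$, and each integer $k$ with $1\leq k\leq d_{\max}$ appears more than once in $\pi$. Then $\pi$ has a connected realization $G$ such that \[ \lambda_{1}(G)\leq\frac{4}{|E(G)|-d_{\max}/2}, \] where $|E(G)|$ is the number of edges of $G$.
   Context: All graphs are finite, without loops or multiple edges. A sequence $\pi=(d_1,\ldots,d_n)$ of nonnegative integers is graphic if there is a graph with $n$ vertices whose vertex degrees are $d_1,\ldots,d_n$; such a graph is a realization of $\pi$. A sequence $\pi$ with largest element $d_{\max}$ is a full sequence if every integer $d$ with $1\leq d\leq d_{\max}$ is an element of $\pi$ and the sum of its elements is even. For a graph $G$ with adjacency matrix $A$ and diagonal degree matrix $D$, the normalized Laplacian is $L=D^{-1}A-I$; its eigenvalues are real and nonpositive, written $-\lambda_0,-\lambda_1,\ldots$ with $0=\lambda_0\leq\lambda_1\leq\cdots$, and $\lambda_1(G)$ denotes the smallest nontrivial such value (the spectral gap). *)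

theory Defs
  imports "Jordan_Normal_Form.Determinant" "Jordan_Normal_Form.Char_Poly"
    "HOL-Computational_Algebra.Polynomial" "HOL-Library.Multiset"
begin

text \<open>Simple graphs on the vertex set {0..<n}: an edge relation E that is
  symmetric and irreflexive (only its restriction to {0..<n} matters).\<close>

definition simple_graph :: "nat \<Rightarrow> (nat \<Rightarrow> nat \<Rightarrow> bool) \<Rightarrow> bool" where
  "simple_graph n E \<longleftrightarrow> (\<forall>i<n. \<forall>j<n. E i j = E j i) \<and> (\<forall>i<n. \<not> E i i)"

definition degree :: "nat \<Rightarrow> (nat \<Rightarrow> nat \<Rightarrow> bool) \<Rightarrow> nat \<Rightarrow> nat" where
  "degree n E i = card {j. j < n \<and> E i j}"

definition num_edges :: "nat \<Rightarrow> (nat \<Rightarrow> nat \<Rightarrow> bool) \<Rightarrow> nat" where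
  "num_edges n E = card {(i, j). i < j \<and> j < n \<and> E i j}"

definition connected_graph :: "nat \<Rightarrow> (nat \<Rightarrow> nat \<Rightarrow> bool) \<Rightarrow> bool" where
  "connected_graph n E \<longleftrightarrow>
     (\<forall>i<n. \<forall>j<n. (i, j) \<in> {(a, b). a < n \<and> b < n \<and> E a b}\<^sup>*)"

text \<open>A realization of the sequence ds: a simple graph on {0..<length ds}
  in which vertex i has degree ds ! i.\<close>

definition realization :: "nat list \<Rightarrow> (nat \<Rightarrow> nat \<Rightarrow> bool) \<Rightarrow> bool" where
  "realization ds E \<longleftrightarrow> simple_graph (length ds) E \<and>
     (\<forall>i < length ds. degree (length ds) E i = ds ! i)"

definition graphic :: "nat list \<Rightarrow> bool" where
  "graphic ds \<longleftrightarrow> (\<exists>E. realization ds E)"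

definition full_sequence :: "nat list \<Rightarrow> bool" where
  "full_sequence ds \<longleftrightarrow> (\<forall>d. 1 \<le> d \<and> d \<le> Max (set ds) \<longrightarrow> d \<in> set ds) \<and> even (sum_list ds)"

definition adj_matrix :: "nat \<Rightarrow> (nat \<Rightarrow> nat \<Rightarrow> bool) \<Rightarrow> real mat" where
  "adj_matrix n E = mat n n (\<lambda>(i, j). if E i j then 1 else 0)"

definition deg_matrix :: "nat \<Rightarrow> (nat \<Rightarrow> nat \<Rightarrow> bool) \<Rightarrow> real mat" where
  "deg_matrix n E = mat_diag n (\<lambda>i. real (degree n E i))"

text \<open>Inverse of the degree matrix (degrees are positive in the intended use).\<close>
definition deg_matrix_inv :: "nat \<Rightarrow> (nat \<Rightarrow> nat \<Rightarrow> bool) \<Rightarrow> real mat" where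
  "deg_matrix_inv n E = mat_diag n (\<lambda>i. 1 / real (degree n E i))"

text \<open>Normalized Laplacian L = D^{-1} A - I.\<close>
definition norm_laplacian :: "nat \<Rightarrow> (nat \<Rightarrow> nat \<Rightarrow> bool) \<Rightarrow> real mat" where
  "norm_laplacian n E = deg_matrix_inv n E * adj_matrix n E - 1\<^sub>m n"

text \<open>The values lambda_0 <= lambda_1 <= ... : the eigenvalues of L are
  -lambda_i, counted with algebraic multiplicity (complex roots of the
  characteristic polynomial; they are real).  Sorted ascending.\<close>
definition lambdas :: "nat \<Rightarrow> (nat \<Rightarrow> nat \<Rightarrow> bool) \<Rightarrow> real list" where
  "lambdas n E = sorted_list_of_multiset
     (image_mset (\<lambda>z. - Re z) (proots (map_poly complex_of_real (char_poly (norm_laplacian n E)))))"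

definition spectral_gap :: "nat \<Rightarrow> (nat \<Rightarrow> nat \<Rightarrow> bool) \<Rightarrow> real" where
  "spectral_gap n E = lambdas n E ! 1"

end

theory Submission
  imports Defs "HOL-Analysis.Function_Topology"
begin

text \<open>
  Distribute the sorted degrees alternately to two halves \<open>A\<close> and \<open>B\<close>. Their degree sums differ by at
  most \<open>dmax\<close>, and both halves contain every degree from \<open>1\<close> to \<open>dmax\<close>. Let \<open>c\<close> be \<open>1\<close> or \<open>2\<close>
  according to the parity of these sums and lower the \<open>c\<close> largest degrees of each half by one. Each half
  is then gap-free and long compared with its maximum, hence graphic by Havel-Hakimi, and its sum is large
  enough for a connected realization. Joining the halves by \<open>c\<close> edges gives \<open>G\<close>. The function that is
  \<open>1 / vol A\<close> on \<open>A\<close> and \<open>- 1 / vol B\<close> on \<open>B\<close> has Rayleigh quotient \<open>c (1 / vol A + 1 / vol B)\<close>,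
  where \<open>vol A + vol B = 2 |E|\<close>, \<open>vol A \<ge> |E|\<close> and \<open>vol B \<ge> |E| - dmax / 2\<close>.

  For the bound of the spectral gap by Rayleigh quotients no diagonalization is needed: a minimizer of the
  Dirichlet form on the mean-zero unit sphere exists by compactness and is an eigenfunction, and its
  eigenvalue is nonzero since \<open>G\<close> is connected, so it is a second root of the characteristic polynomial.
\<close>

section \<open>Rayleigh quotients\<close>

text \<open>Weights at least 1 confine the mean-zero unit sphere to the cube \<open>B\<close>, so a
  minimizer exists by compactness. \<open>Q\<close> and the norm are both homogeneous of degree 2,
  which carries the inequality from the sphere to every mean-zero \<open>g\<close>. The function
  \<open>h\<close> witnesses that the sphere is nonempty.\<close>

lemma ex_constrained_minimizer:
  fixes a :: "nat \<Rightarrow> nat \<Rightarrow> real" and w h :: "nat \<Rightarrow> real"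
  assumes w: "\<And>i. i < n \<Longrightarrow> 1 \<le> w i"
    and h: "(\<Sum>i<n. w i * h i) = 0" "0 < (\<Sum>i<n. w i * (h i)\<^sup>2)"
  defines "Q \<equiv> \<lambda>g. \<Sum>i<n. \<Sum>j<n. a i j * g i * g j"
  shows "\<exists>f. (\<Sum>i<n. w i * f i) = 0 \<and> (\<Sum>i<n. w i * (f i)\<^sup>2) = 1 \<and>
    (\<forall>g. (\<Sum>i<n. w i * g i) = 0 \<longrightarrow> Q f * (\<Sum>i<n. w i * (g i)\<^sup>2) \<le> Q g)"
proof -
  define N where "N g = (\<Sum>i<n. w i * (g i)\<^sup>2)" for g :: "nat \<Rightarrow> real"
  define M where "M g = (\<Sum>i<n. w i * g i)" for g :: "nat \<Rightarrow> real"
  \<comment> \<open>Functions live on all of \<open>nat\<close>; pinning the coordinates from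
    \<open>n\<close> on to 0 makes \<open>B\<close> a product of compact sets.\<close>
  define B where "B = (\<Pi>\<^sub>E i\<in>(UNIV :: nat set). if i < n then {-1..1::real} else {0})"
  define K where "K = B \<inter> {g. N g = 1} \<inter> {g. M g = 0}"
  have nn: "0 \<le> w i * x\<^sup>2" if "i < n" for i x using w[OF that] by simp
  define nrm where "nrm g i = (if i < n then g i / sqrt (N g) else 0)" for g :: "nat \<Rightarrow> real" and i
  have nrm_Q: "Q (nrm g) = Q g / N g" and nrm_K: "nrm g \<in> K" if "0 < N g" "M g = 0" for g
  proof -
    have ss: "sqrt (N g) * sqrt (N g) = N g" using that by simp
    have N1: "N (nrm g) = 1"
    proof -
      have "N (nrm g) = (\<Sum>i<n. w i * (g i)\<^sup>2 / N g)"
        unfolding N_def[of "nrm g"] using that by (intro sum.cong) (auto simp: nrm_def power_divide)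
      also have "\<dots> = N g / N g" unfolding sum_divide_distrib[symmetric] N_def ..
      finally show ?thesis using that by simp
    qed
    have M0: "M (nrm g) = 0"
    proof -
      have "M (nrm g) = (\<Sum>i<n. w i * g i / sqrt (N g))"
        unfolding M_def by (intro sum.cong) (auto simp: nrm_def)
      also have "\<dots> = M g / sqrt (N g)" unfolding sum_divide_distrib[symmetric] M_def ..
      finally show ?thesis using that by simp
    qed
    have "nrm g i \<in> {-1..1}" if i: "i < n" for i
    proof -
      have "(nrm g i)\<^sup>2 \<le> w i * (nrm g i)\<^sup>2" using w[OF i] by (simp add: mult_le_cancel_right1)
      also have "\<dots> \<le> N (nrm g)"
        unfolding N_def using i nn by (intro member_le_sum) auto
      finally have "(nrm g i)\<^sup>2 \<le> 1" using N1 by simp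
      then have "\<bar>nrm g i\<bar> \<le> 1" by (simp add: abs_square_le_1)
      then show ?thesis by (simp add: abs_le_iff)
    qed
    then have "nrm g \<in> B" by (simp add: B_def PiE_iff nrm_def)
    then show "nrm g \<in> K" using N1 M0 by (simp add: K_def)
    have "Q (nrm g) = (\<Sum>i<n. \<Sum>j<n. a i j * g i * g j / N g)"
      unfolding Q_def using that by (intro sum.cong) (simp_all add: nrm_def ss times_divide_times_eq)
    then show "Q (nrm g) = Q g / N g" by (simp add: Q_def sum_divide_distrib)
  qed
  have cont: "continuous_on UNIV Q" "continuous_on UNIV N" "continuous_on UNIV M"
    unfolding Q_def N_def M_def by (intro continuous_intros continuous_on_product_coordinates)+
  have "compact B"
  proof -
    have "compactin (product_topology (\<lambda>i. euclidean) UNIV) B"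
      unfolding B_def by (subst compactin_PiE) auto
    then show ?thesis by (simp add: euclidean_product_topology)
  qed
  moreover have "closed ({g. N g = 1} \<inter> {g. M g = 0})"
    by (intro closed_Int closed_Collect_eq cont continuous_on_const)
  ultimately have "compact K" unfolding K_def Int_assoc by (rule compact_Int_closed)
  moreover have "K \<noteq> {}" using nrm_K[of h] h unfolding N_def M_def by blast
  moreover have "continuous_on K Q" using cont(1) continuous_on_subset by blast
  ultimately obtain f where f: "f \<in> K" and fmin: "\<And>g. g \<in> K \<Longrightarrow> Q f \<le> Q g"
    using continuous_attains_inf[of K Q] by blast
  have "Q f * N g \<le> Q g" if g: "M g = 0" for g
  proof (cases "0 < N g")
    case True
    then show ?thesis using fmin[OF nrm_K[OF True g]] nrm_Q[OF True g] by (simp add: field_simps)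
  next
    case False
    have "0 \<le> N g" unfolding N_def using nn by (intro sum_nonneg) auto
    then have N0: "N g = 0" using False by simp
    then have "\<forall>i<n. w i * (g i)\<^sup>2 = 0"
      using nn by (subst (asm) N_def, subst (asm) sum_nonneg_eq_0_iff) auto
    then have "g i = 0" if "i < n" for i using w[OF that] that by force
    then show ?thesis using N0 by (simp add: Q_def)
  qed
  then show ?thesis using f unfolding K_def M_def N_def by (intro exI[of _ f]) auto
qed

text \<open>First variation at the minimizer: along an admissible direction \<open>Q - l N\<close>
  is a nonnegative quadratic in \<open>t\<close> that vanishes at 0, so its linear term is 0. The
  Lagrange multiplier is \<open>Q f\<close> because \<open>f\<close> has norm 1, and the last
  conjunct is minimality tested on \<open>h\<close>.\<close>

lemma ex_eigenfunction_le_rayleigh: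
  fixes a :: "nat \<Rightarrow> nat \<Rightarrow> real" and w h :: "nat \<Rightarrow> real"
  assumes sym: "\<And>i j. i < n \<Longrightarrow> j < n \<Longrightarrow> a i j = a j i"
    and rows: "\<And>i. i < n \<Longrightarrow> (\<Sum>j<n. a i j) = 0"
    and w: "\<And>i. i < n \<Longrightarrow> 1 \<le> w i"
    and h: "(\<Sum>i<n. w i * h i) = 0" "0 < (\<Sum>i<n. w i * (h i)\<^sup>2)"
  shows "\<exists>f l. (\<Sum>i<n. w i * f i) = 0 \<and> (\<Sum>i<n. w i * (f i)\<^sup>2) = 1 \<and>
    l = (\<Sum>i<n. \<Sum>j<n. a i j * f i * f j) \<and> (\<forall>i<n. (\<Sum>j<n. a i j * f j) = l * w i * f i) \<and>
    l * (\<Sum>i<n. w i * (h i)\<^sup>2) \<le> (\<Sum>i<n. \<Sum>j<n. a i j * h i * h j)"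
proof -
  define Q where "Q g = (\<Sum>i<n. \<Sum>j<n. a i j * g i * g j)" for g :: "nat \<Rightarrow> real"
  define N where "N g = (\<Sum>i<n. w i * (g i)\<^sup>2)" for g :: "nat \<Rightarrow> real"
  define M where "M g = (\<Sum>i<n. w i * g i)" for g :: "nat \<Rightarrow> real"
  obtain f where f: "M f = 0" "N f = 1" and min: "\<And>g. M g = 0 \<Longrightarrow> Q f * N g \<le> Q g"
    using ex_constrained_minimizer[where a = a and w = w and h = h and n = n, OF w h]
    unfolding Q_def N_def M_def by blast
  define l where "l = Q f"
  define G where "G i = (\<Sum>j<n. a i j * f j) - l * w i * f i" for i
  \<comment> \<open>\<open>G\<close> is half the gradient of \<open>Q - l N\<close>; dividing by the weights makes it an admissible direction,
    because the column sums of \<open>a\<close> vanish.\<close>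
  define g where "g i = G i / w i" for i
  define b where "b = (\<Sum>i<n. G i * g i)"
  define c where "c = Q g - l * N g"
  have wg: "w i * g i = G i" if "i < n" for i using w[OF that] by (simp add: g_def)
  have "M g = (\<Sum>i<n. G i)" unfolding M_def using wg by simp
  also have "\<dots> = (\<Sum>i<n. \<Sum>j<n. a i j * f j) - l * M f"
    unfolding G_def M_def by (simp add: sum_subtractf sum_distrib_left mult.assoc)
  also have "(\<Sum>i<n. \<Sum>j<n. a i j * f j) = (\<Sum>j<n. (\<Sum>i<n. a j i) * f j)"
    by (subst sum.swap) (auto simp: sum_distrib_right sym intro!: sum.cong)
  also have "\<dots> = 0" using rows by simp
  finally have Mg: "M g = 0" using f by simp
  have expand: "Q (\<lambda>i. f i + t * g i) - l * N (\<lambda>i. f i + t * g i) = 2 * t * b + t\<^sup>2 * c" for t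
  proof -
    have swap: "(\<Sum>i<n. \<Sum>j<n. a i j * f i * g j) = (\<Sum>i<n. \<Sum>j<n. a i j * g i * f j)"
      by (subst sum.swap) (auto simp: sym algebra_simps intro!: sum.cong)
    have "Q (\<lambda>i. f i + t * g i) =
        (\<Sum>i<n. \<Sum>j<n. a i j * f i * f j + t * (a i j * f i * g j) + t * (a i j * g i * f j)
          + t\<^sup>2 * (a i j * g i * g j))"
      unfolding Q_def by (intro sum.cong refl) (simp add: algebra_simps power2_eq_square)
    also have "\<dots> = Q f + 2 * t * (\<Sum>i<n. \<Sum>j<n. a i j * g i * f j) + t\<^sup>2 * Q g"
      using swap by (simp add: sum.distrib sum_distrib_left[symmetric] Q_def)
    finally have 1: "Q (\<lambda>i. f i + t * g i) =
      Q f + 2 * t * (\<Sum>i<n. \<Sum>j<n. a i j * g i * f j) + t\<^sup>2 * Q g" .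
    have "N (\<lambda>i. f i + t * g i) =
        (\<Sum>i<n. w i * (f i)\<^sup>2 + 2 * t * (w i * f i * g i) + t\<^sup>2 * (w i * (g i)\<^sup>2))"
      unfolding N_def by (intro sum.cong refl) (simp add: algebra_simps power2_eq_square)
    also have "\<dots> = N f + 2 * t * (\<Sum>i<n. w i * f i * g i) + t\<^sup>2 * N g"
      by (simp add: sum.distrib sum_distrib_left[symmetric] N_def)
    finally have 2: "N (\<lambda>i. f i + t * g i) = N f + 2 * t * (\<Sum>i<n. w i * f i * g i) + t\<^sup>2 * N g" .
    have 3: "b = (\<Sum>i<n. \<Sum>j<n. a i j * g i * f j) - l * (\<Sum>i<n. w i * f i * g i)"
      unfolding b_def G_def
      by (simp add: left_diff_distrib sum_subtractf sum_distrib_right sum_distrib_left algebra_simps)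
    show ?thesis unfolding 1 2 3 c_def using f(2) l_def by (simp add: algebra_simps)
  qed
  have c0: "0 \<le> c" using min[OF Mg] by (simp add: c_def l_def)
  have Gg: "0 \<le> G i * g i" if "i < n" for i using w[OF that] by (simp add: g_def)
  have b0: "0 \<le> b" unfolding b_def using Gg by (intro sum_nonneg) auto
  have var: "0 \<le> 2 * t * b + t\<^sup>2 * c" for t
  proof -
    have "M (\<lambda>i. f i + t * g i) = M f + t * M g"
      unfolding M_def by (simp add: distrib_left sum.distrib sum_distrib_left mult.left_commute)
    then have "l * N (\<lambda>i. f i + t * g i) \<le> Q (\<lambda>i. f i + t * g i)"
      using min f Mg by (simp add: l_def)
    then show ?thesis using expand[of t] by simp
  qed
  have "b = 0"
  proof (rule ccontr)
    assume "b \<noteq> 0"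
    then have bp: "0 < b" using b0 by simp
    \<comment> \<open>Small enough for the linear term to win: at \<open>- t\<close> the value is
      \<open>t * (t * c - 2 * b)\<close>, negative since \<open>t * c\<close> is at most
      \<open>b\<close>. The \<open>+ 1\<close> covers \<open>c = 0\<close>.\<close>
    define t where "t = b / (c + 1)"
    have t: "0 < t" "t * c \<le> b" using bp c0 by (auto simp: t_def field_simps)
    have "0 \<le> t * (t * c - 2 * b)" using var[of "- t"] by (simp add: algebra_simps power2_eq_square)
    then show False using t bp by (simp add: zero_le_mult_iff)
  qed
  then have "\<forall>i<n. G i * g i = 0"
    using Gg unfolding b_def by (subst (asm) sum_nonneg_eq_0_iff) auto
  then have "G i = 0" if "i < n" for i using w[OF that] that by (force simp: g_def)
  then have "\<forall>i<n. (\<Sum>j<n. a i j * f j) = l * w i * f i" by (simp add: G_def)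
  moreover have "l * N h \<le> Q h" using min[of h] h(1) by (simp add: l_def M_def)
  ultimately show ?thesis
    using f l_def unfolding M_def N_def Q_def by blast
qed

section \<open>The graph Laplacian and bounds for the spectral gap\<close>

definition adj :: "(nat \<Rightarrow> nat \<Rightarrow> bool) \<Rightarrow> nat \<Rightarrow> nat \<Rightarrow> real" where
  "adj E i j = of_bool (E i j)"

text \<open>The symmetric matrix \<open>D - A\<close>. For positive degrees,
  \<open>norm_laplacian\<close> is obtained by dividing its rows by the negated degrees, so
  eigenvalues turn into generalized ones with the degrees as weights.\<close>

definition lap :: "nat \<Rightarrow> (nat \<Rightarrow> nat \<Rightarrow> bool) \<Rightarrow> nat \<Rightarrow> nat \<Rightarrow> real" where
  "lap n E i j = of_bool (i = j) * real (Defs.degree n E i) - adj E i j"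

lemma sum_adj: "(\<Sum>j<n. adj E i j) = real (Defs.degree n E i)"
proof -
  have "(\<Sum>j<n. adj E i j) = real (card ({..<n} \<inter> {j. E i j}))"
    by (simp add: adj_def of_bool_def sum.If_cases)
  also have "{..<n} \<inter> {j. E i j} = {j. j < n \<and> E i j}" by auto
  finally show ?thesis by (simp add: Defs.degree_def)
qed

lemma sum_of_bool_eq: "(i::nat) < n \<Longrightarrow> (\<Sum>j<n. of_bool (i = j) * (F j :: real)) = F i"
  by (simp add: of_bool_def if_distrib[where f = "\<lambda>x. x * _"] cong: if_cong)

lemma sum_lap_mult:
  "i < n \<Longrightarrow> (\<Sum>j<n. lap n E i j * f j) = real (Defs.degree n E i) * f i - (\<Sum>j<n. adj E i j * f j)"
  using sum_of_bool_eq[of i n "\<lambda>j. real (Defs.degree n E i) * f j"]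
  by (simp add: lap_def left_diff_distrib sum_subtractf mult.assoc)

text \<open>Expanding the square gives two diagonal sums, equal by symmetry, and a cross term.
  Ordered pairs count every edge twice, hence the division by 2.\<close>

lemma dirichlet_form:
  assumes "simple_graph n E"
  shows "(\<Sum>i<n. \<Sum>j<n. lap n E i j * g i * g j) = (\<Sum>i<n. \<Sum>j<n. adj E i j * (g i - g j)\<^sup>2) / 2"
proof -
  let ?d = "\<lambda>i. real (Defs.degree n E i)"
  have sym: "adj E i j = adj E j i" if "i < n" "j < n" for i j
    using assms that by (auto simp: simple_graph_def adj_def)
  have 1: "(\<Sum>i<n. \<Sum>j<n. adj E i j * (g i)\<^sup>2) = (\<Sum>i<n. ?d i * (g i)\<^sup>2)"
    by (simp add: sum_distrib_right[symmetric] sum_adj)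
  have 2: "(\<Sum>i<n. \<Sum>j<n. adj E i j * (g j)\<^sup>2) = (\<Sum>i<n. ?d i * (g i)\<^sup>2)"
    by (subst sum.swap, subst 1[symmetric]) (auto intro!: sum.cong simp: sym)
  have "(\<Sum>i<n. \<Sum>j<n. adj E i j * (g i - g j)\<^sup>2) =
      (\<Sum>i<n. \<Sum>j<n. adj E i j * (g i)\<^sup>2 + adj E i j * (g j)\<^sup>2 - 2 * (adj E i j * g i * g j))"
    by (intro sum.cong refl) (simp add: power2_diff algebra_simps)
  also have "\<dots> = 2 * (\<Sum>i<n. ?d i * (g i)\<^sup>2) - 2 * (\<Sum>i<n. \<Sum>j<n. adj E i j * g i * g j)"
    by (simp add: sum.distrib sum_subtractf 1 2 sum_distrib_left)
  finally have 3: "(\<Sum>i<n. \<Sum>j<n. adj E i j * (g i - g j)\<^sup>2) / 2 =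
      (\<Sum>i<n. ?d i * (g i)\<^sup>2) - (\<Sum>i<n. \<Sum>j<n. adj E i j * g i * g j)" by simp
  have "(\<Sum>i<n. \<Sum>j<n. lap n E i j * g i * g j) = (\<Sum>i<n. g i * (\<Sum>j<n. lap n E i j * g j))"
    by (simp add: sum_distrib_left mult_ac)
  also have "\<dots> = (\<Sum>i<n. ?d i * (g i)\<^sup>2 - (\<Sum>j<n. adj E i j * g i * g j))"
    by (intro sum.cong refl, subst sum_lap_mult)
      (simp_all add: right_diff_distrib sum_distrib_left power2_eq_square mult_ac)
  finally show ?thesis unfolding 3 by (simp add: sum_subtractf)
qed

lemma norm_laplacian_carrier: "norm_laplacian n E \<in> carrier_mat n n"
  unfolding norm_laplacian_def deg_matrix_inv_def adj_matrix_def
  by (intro minus_carrier_mat one_carrier_mat)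

lemma norm_laplacian_index:
  assumes "0 < Defs.degree n E i" "i < n" "j < n"
  shows "norm_laplacian n E $$ (i, j) = - lap n E i j / real (Defs.degree n E i)"
proof -
  have "norm_laplacian n E $$ (i, j) =
      1 / real (Defs.degree n E i) * adj E i j - of_bool (i = j)"
    unfolding norm_laplacian_def deg_matrix_inv_def
    by (subst mat_diag_mult_left[of _ n n]) (use assms in \<open>auto simp: adj_matrix_def adj_def\<close>)
  then show ?thesis using assms by (auto simp: lap_def field_simps)
qed

lemma eigenvalue_mem_lambdas:
  assumes deg: "\<forall>i<n. 0 < Defs.degree n E i"
    and f: "\<forall>i<n. (\<Sum>j<n. lap n E i j * f j) = l * real (Defs.degree n E i) * f i"
    and k: "k < n" "f k \<noteq> 0"
  shows "l \<in> set (lambdas n E)"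
proof -
  let ?L = "norm_laplacian n E"
  note L = norm_laplacian_carrier[of n E]
  define v where "v = Matrix.vec n f"
  have "eigenvector ?L v (- l)"
    unfolding eigenvector_def
  proof (intro conjI)
    show "v \<in> carrier_vec (dim_row ?L)" using L by (simp add: v_def)
    show "v \<noteq> 0\<^sub>v (dim_row ?L)"
    proof
      assume "v = 0\<^sub>v (dim_row ?L)"
      then have "v $ k = 0" using L k by simp
      then show False using k by (simp add: v_def)
    qed
    show "?L *\<^sub>v v = - l \<cdot>\<^sub>v v"
    proof (rule eq_vecI)
      fix i assume "i < dim_vec (- l \<cdot>\<^sub>v v)"
      then have i: "i < n" by (simp add: v_def)
      have "(?L *\<^sub>v v) $ i = (\<Sum>j<n. ?L $$ (i, j) * f j)"
        using L i by (simp add: v_def scalar_prod_def lessThan_atLeast0)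
      also have "\<dots> = (\<Sum>j<n. - (lap n E i j * f j) / real (Defs.degree n E i))"
        using norm_laplacian_index deg i by (intro sum.cong) auto
      also have "\<dots> = - l * f i"
        using f i deg unfolding sum_divide_distrib[symmetric] sum_negf by auto
      finally show "(?L *\<^sub>v v) $ i = (- l \<cdot>\<^sub>v v) $ i" using i by (simp add: v_def)
    qed (use L in \<open>simp add: v_def\<close>)
  qed
  then have root: "poly (char_poly ?L) (- l) = 0"
    using eigenvalue_root_char_poly[OF L] unfolding eigenvalue_def by blast
  let ?p = "map_poly complex_of_real (char_poly ?L)"
  have "char_poly ?L \<noteq> 0" using degree_monic_char_poly[OF L] by auto
  then have "?p \<noteq> 0" by simp
  moreover have "poly ?p (complex_of_real (- l)) = 0"
    using root by (metis of_real_0 of_real_hom.poly_map_poly)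
  ultimately have "complex_of_real (- l) \<in># proots ?p" by simp
  then have "- Re (complex_of_real (- l)) \<in># image_mset (\<lambda>z. - Re z) (proots ?p)"
    by (metis (no_types, lifting) imageI set_image_mset)
  then show ?thesis by (simp add: lambdas_def)
qed

text \<open>The larger of two distinct members cannot stand at position 0. This lets two different
  eigenvalues bound the spectral gap without a discussion of multiplicities.\<close>

lemma sorted_nth_1_le:
  assumes "sorted xs" "x \<in> set xs" "y \<in> set xs" "x < y"
  shows "xs ! 1 \<le> y"
proof -
  obtain j where j: "j < length xs" "xs ! j = y" using assms(3) by (auto simp: in_set_conv_nth)
  obtain i where i: "i < length xs" "xs ! i = x" using assms(2) by (auto simp: in_set_conv_nth)
  have "j \<noteq> 0" using sorted_nth_mono[OF assms(1), of j i] i j assms(4) by (intro notI) simp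
  then show ?thesis using sorted_nth_mono[OF assms(1), of 1 j] j by simp
qed

text \<open>The minimal value \<open>l\<close> is an eigenvalue and nonnegative by the Dirichlet
  form. If it were 0, its eigenfunction would be constant along edges, hence constant by
  connectivity, hence 0 by the mean-zero condition. So 0 and \<open>l\<close> are distinct entries
  of \<open>lambdas\<close>.\<close>

lemma spectral_gap_le_rayleigh:
  assumes S: "simple_graph n E" and C: "connected_graph n E"
    and deg: "\<forall>i<n. 0 < Defs.degree n E i"
    and h: "(\<Sum>i<n. real (Defs.degree n E i) * h i) = 0"
      "0 < (\<Sum>i<n. real (Defs.degree n E i) * (h i)\<^sup>2)"
  shows "spectral_gap n E * (\<Sum>i<n. real (Defs.degree n E i) * (h i)\<^sup>2)
    \<le> (\<Sum>i<n. \<Sum>j<n. adj E i j * (h i - h j)\<^sup>2) / 2"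
proof -
  let ?d = "\<lambda>i. real (Defs.degree n E i)"
  have sym: "lap n E i j = lap n E j i" if "i < n" "j < n" for i j
    using S that by (auto simp: simple_graph_def adj_def lap_def)
  have rows: "(\<Sum>j<n. lap n E i j) = 0" if "i < n" for i
    using sum_lap_mult[OF that, of E "\<lambda>_. 1"] by (simp add: sum_adj)
  have d1: "1 \<le> ?d i" if "i < n" for i
    using deg that by (simp add: Suc_le_eq)
  obtain f l where f: "(\<Sum>i<n. ?d i * f i) = 0" "(\<Sum>i<n. ?d i * (f i)\<^sup>2) = 1"
    and l: "l = (\<Sum>i<n. \<Sum>j<n. lap n E i j * f i * f j)"
    and ev: "\<forall>i<n. (\<Sum>j<n. lap n E i j * f j) = l * ?d i * f i"
    and le: "l * (\<Sum>i<n. ?d i * (h i)\<^sup>2) \<le> (\<Sum>i<n. \<Sum>j<n. lap n E i j * h i * h j)"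
    using ex_eigenfunction_le_rayleigh[where a = "lap n E" and w = ?d and h = h and n = n,
        OF sym rows d1 h] by blast
  obtain k where k: "k < n" "f k \<noteq> 0"
  proof -
    have "\<not> (\<forall>i<n. f i = 0)" using f(2) by (intro notI) simp
    then show thesis using that by blast
  qed
  have nn: "0 \<le> adj E i j * (f i - f j)\<^sup>2" for i j by (simp add: adj_def)
  have l_eq: "l = (\<Sum>i<n. \<Sum>j<n. adj E i j * (f i - f j)\<^sup>2) / 2"
    using dirichlet_form[OF S] l by simp
  have "0 \<le> l" unfolding l_eq using nn by (intro divide_nonneg_nonneg sum_nonneg) auto
  moreover have "l \<noteq> 0"
  proof
    assume "l = 0"
    then have "(\<Sum>i<n. \<Sum>j<n. adj E i j * (f i - f j)\<^sup>2) = 0" using l_eq by simp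
    then have "\<forall>i<n. (\<Sum>j<n. adj E i j * (f i - f j)\<^sup>2) = 0"
      using nn by (subst (asm) sum_nonneg_eq_0_iff) (auto intro: sum_nonneg)
    then have "\<forall>i<n. \<forall>j<n. adj E i j * (f i - f j)\<^sup>2 = 0"
      using nn by (subst (asm) sum_nonneg_eq_0_iff) auto
    then have edge: "f i = f j" if "i < n" "j < n" "E i j" for i j
      using that by (force simp: adj_def)
    have "f i = f k" if "i < n" for i
    proof -
      have "(i, k) \<in> {(a, b). a < n \<and> b < n \<and> E a b}\<^sup>*"
        using C that k unfolding connected_graph_def by blast
      then show ?thesis by (induction rule: rtrancl_induct) (use edge in auto)
    qed
    then have "(\<Sum>i<n. ?d i * f i) = (\<Sum>i<n. ?d i) * f k" by (simp add: sum_distrib_right)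
    moreover have "0 < (\<Sum>i<n. ?d i)" using k deg by (intro sum_pos) auto
    ultimately show False using f(1) k by simp
  qed
  ultimately have l0: "0 < l" by simp
  have "l \<in> set (lambdas n E)" by (rule eigenvalue_mem_lambdas[OF deg ev k])
  \<comment> \<open>The rows of \<open>lap\<close> sum to 0, so constants are eigenfunctions for
    0.\<close>
  moreover have "0 \<in> set (lambdas n E)"
    by (rule eigenvalue_mem_lambdas[OF deg, where f = "\<lambda>_. 1", OF _ k(1)]) (use rows in auto)
  ultimately have "spectral_gap n E \<le> l"
    unfolding spectral_gap_def using l0 by (intro sorted_nth_1_le[where x = 0]) (auto simp: lambdas_def)
  then have "spectral_gap n E * (\<Sum>i<n. ?d i * (h i)\<^sup>2) \<le> l * (\<Sum>i<n. ?d i * (h i)\<^sup>2)"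
    using h(2) by (intro mult_right_mono) auto
  then show ?thesis using le dirichlet_form[OF S, of h] by simp
qed

text \<open>Test with the function \<open>1 / a\<close> on \<open>A\<close> and
  \<open>- 1 / b\<close> on \<open>B\<close>: it is orthogonal to constants, has squared norm
  \<open>1 / a + 1 / b\<close>, and only the \<open>c\<close> cut edges contribute to its Dirichlet
  form, each with \<open>(1 / a + 1 / b)^2\<close>.\<close>

lemma spectral_gap_le_cut:
  assumes S: "simple_graph n E" and C: "connected_graph n E"
    and deg: "\<forall>i<n. 0 < Defs.degree n E i"
    and A: "A \<union> B = {..<n}" "A \<inter> B = {}" "A \<noteq> {}" "B \<noteq> {}"
  defines "a \<equiv> real (\<Sum>i\<in>A. Defs.degree n E i)" and "b \<equiv> real (\<Sum>i\<in>B. Defs.degree n E i)"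
    and "c \<equiv> real (card {(i, j). i \<in> A \<and> j \<in> B \<and> E i j})"
  shows "spectral_gap n E \<le> c * (1 / a + 1 / b)"
proof -
  let ?d = "\<lambda>i. real (Defs.degree n E i)"
  have fin: "finite A" "finite B" using A(1) by (metis finite_Un finite_lessThan)+
  have pos: "0 < a" "0 < b"
    unfolding a_def b_def using fin A deg by (auto intro!: sum_pos)
  define h where "h i = (if i \<in> A then 1 / a else - 1 / b)" for i
  have split: "(\<Sum>i<n. F i) = (\<Sum>i\<in>A. F i) + (\<Sum>i\<in>B. F i)" for F :: "nat \<Rightarrow> real"
    unfolding A(1)[symmetric] using fin A(2) by (simp add: sum.union_disjoint)
  have hA: "h i = 1 / a" if "i \<in> A" for i using that by (simp add: h_def)
  have hB: "h i = - 1 / b" if "i \<in> B" for i using that A(2) by (auto simp: h_def)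
  have "(\<Sum>i<n. ?d i * h i) = (\<Sum>i\<in>A. ?d i) * (1 / a) + (\<Sum>i\<in>B. ?d i) * (- 1 / b)"
    unfolding split sum_distrib_right using hA hB by simp
  then have h0: "(\<Sum>i<n. ?d i * h i) = 0" using pos by (simp add: a_def b_def)
  have "(\<Sum>i<n. ?d i * (h i)\<^sup>2) = (\<Sum>i\<in>A. ?d i) * (1 / a)\<^sup>2 + (\<Sum>i\<in>B. ?d i) * (- 1 / b)\<^sup>2"
    unfolding split sum_distrib_right using hA hB by simp
  also have "\<dots> = a * (1 / a)\<^sup>2 + b * (- 1 / b)\<^sup>2" by (simp add: a_def b_def)
  also have "\<dots> = 1 / a + 1 / b" using pos by (simp add: power2_eq_square)
  finally have h2: "(\<Sum>i<n. ?d i * (h i)\<^sup>2) = 1 / a + 1 / b" .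
  have hp: "0 < 1 / a + 1 / b" using pos by (simp add: add_pos_pos)
  have card_adj: "(\<Sum>i\<in>A. \<Sum>j\<in>B. adj E i j) = c"
  proof -
    have "(\<Sum>i\<in>A. \<Sum>j\<in>B. adj E i j) = (\<Sum>(i, j)\<in>A \<times> B. adj E i j)"
      by (rule sum.cartesian_product)
    also have "\<dots> = (\<Sum>p\<in>A \<times> B. of_bool (p \<in> {(i, j). E i j}))"
      by (rule sum.cong) (auto simp: adj_def)
    also have "\<dots> = real (card (A \<times> B \<inter> {(i, j). E i j}))"
      using fin by (simp add: of_bool_def sum.If_cases del: mem_Collect_eq)
    also have "A \<times> B \<inter> {(i, j). E i j} = {(i, j). i \<in> A \<and> j \<in> B \<and> E i j}" by auto
    finally show ?thesis by (simp add: c_def)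
  qed
  have sym: "adj E i j = adj E j i" if "i \<in> A" "j \<in> B" for i j
    using S A(1) that by (auto simp: simple_graph_def adj_def)
  have "(\<Sum>i<n. \<Sum>j<n. adj E i j * (h i - h j)\<^sup>2) =
      (\<Sum>i\<in>A. \<Sum>j\<in>B. adj E i j * (1 / a + 1 / b)\<^sup>2) + (\<Sum>i\<in>B. \<Sum>j\<in>A. adj E i j * (1 / a + 1 / b)\<^sup>2)"
  proof -
    have "(1 / a - - 1 / b)\<^sup>2 = (1 / a + 1 / b)\<^sup>2" "(- 1 / b - 1 / a)\<^sup>2 = (1 / a + 1 / b)\<^sup>2"
      by (simp_all add: power2_eq_square algebra_simps)
    then show ?thesis unfolding split using hA hB by (simp add: sum.distrib)
  qed
  \<comment> \<open>The cut is seen once from each side, which cancels the factor 1/2 of the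
    Dirichlet form.\<close>
  also have "(\<Sum>i\<in>B. \<Sum>j\<in>A. adj E i j * (1 / a + 1 / b)\<^sup>2) = (\<Sum>i\<in>A. \<Sum>j\<in>B. adj E i j * (1 / a + 1 / b)\<^sup>2)"
    by (subst sum.swap) (auto simp: sym intro!: sum.cong)
  also have "(\<Sum>i\<in>A. \<Sum>j\<in>B. adj E i j * (1 / a + 1 / b)\<^sup>2) = c * (1 / a + 1 / b)\<^sup>2"
    by (simp add: sum_distrib_right[symmetric] card_adj)
  finally have "spectral_gap n E * (1 / a + 1 / b) \<le> c * (1 / a + 1 / b)\<^sup>2"
    using spectral_gap_le_rayleigh[OF S C deg h0] hp unfolding h2 by simp
  then have "spectral_gap n E * (1 / a + 1 / b) \<le> (c * (1 / a + 1 / b)) * (1 / a + 1 / b)"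
    by (simp add: power2_eq_square mult.assoc)
  then show ?thesis using hp by (rule mult_right_le_imp_le)
qed

section \<open>Realizations of degree functions\<close>

text \<open>A counterpart of \<open>realization\<close> for any vertex set, so that induction can
  delete vertices without renumbering. Edges are confined to \<open>V\<close>, so neighbourhoods
  need no restriction.\<close>

definition realizes :: "'a set \<Rightarrow> ('a \<Rightarrow> nat) \<Rightarrow> ('a \<Rightarrow> 'a \<Rightarrow> bool) \<Rightarrow> bool" where
  "realizes V f E \<longleftrightarrow>
     (\<forall>x y. E x y \<longrightarrow> x \<in> V \<and> y \<in> V \<and> x \<noteq> y \<and> E y x) \<and> (\<forall>x\<in>V. card {y. E x y} = f x)"

definition linked :: "'a set \<Rightarrow> ('a \<Rightarrow> 'a \<Rightarrow> bool) \<Rightarrow> bool" where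
  "linked V E \<longleftrightarrow> (\<forall>x\<in>V. \<forall>y\<in>V. E\<^sup>*\<^sup>* x y)"

definition join_vertex :: "'a \<Rightarrow> 'a set \<Rightarrow> ('a \<Rightarrow> 'a \<Rightarrow> bool) \<Rightarrow> 'a \<Rightarrow> 'a \<Rightarrow> bool" where
  "join_vertex v T E x y \<longleftrightarrow> E x y \<or> x = v \<and> y \<in> T \<or> y = v \<and> x \<in> T"

lemma realizesD:
  assumes "realizes V f E" "E x y"
  shows "x \<in> V" "y \<in> V" "x \<noteq> y" "E y x"
  using assms unfolding realizes_def by blast+

lemma realizes_card: "realizes V f E \<Longrightarrow> x \<in> V \<Longrightarrow> card {y. E x y} = f x"
  unfolding realizes_def by blast

lemma realizes_nbhd_subset: "realizes V f E \<Longrightarrow> {y. E x y} \<subseteq> V - {x}"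
  unfolding realizes_def by blast

lemma realizes_finite_nbhd: "finite V \<Longrightarrow> realizes V f E \<Longrightarrow> finite {y. E x y}"
  by (meson finite_Diff finite_subset realizes_nbhd_subset)

lemma realizes_join_vertex:
  assumes fin: "finite V" and R: "realizes V g E" and v: "v \<notin> V" and T: "T \<subseteq> V"
    and fv: "f v = card T" and f: "\<And>x. x \<in> V \<Longrightarrow> f x = g x + of_bool (x \<in> T)"
  shows "realizes (insert v V) f (join_vertex v T E)"
proof -
  have nv: "\<not> E v y" "\<not> E y v" for y
    using realizesD[OF R] v by blast+
  have "card {y. join_vertex v T E x y} = f x" if x: "x \<in> insert v V" for x
  proof (cases "x = v")
    case True
    have "{y. join_vertex v T E x y} = T"
      using True nv v T by (auto simp: join_vertex_def)
    then show ?thesis using True fv by simp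
  next
    case False
    then have xV: "x \<in> V" using x by simp
    have eq: "{y. join_vertex v T E x y} = (if x \<in> T then insert v {y. E x y} else {y. E x y})"
      using False by (auto simp: join_vertex_def)
    show ?thesis
      unfolding eq using nv realizes_finite_nbhd[OF fin R] realizes_card[OF R xV] f[OF xV] by auto
  qed
  moreover have "\<forall>x y. join_vertex v T E x y \<longrightarrow>
      x \<in> insert v V \<and> y \<in> insert v V \<and> x \<noteq> y \<and> join_vertex v T E y x"
    using realizesD[OF R] T v unfolding join_vertex_def by blast
  ultimately show ?thesis unfolding realizes_def by blast
qed

lemma linked_join_vertex:
  assumes L: "linked V E" and T: "T \<subseteq> V" "T \<noteq> {}"
  shows "linked (insert v V) (join_vertex v T E)"
proof -
  let ?J = "join_vertex v T E"
  obtain t where t: "t \<in> T" "t \<in> V" using T by blast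
  have 1: "?J\<^sup>*\<^sup>* x y" if "x \<in> V" "y \<in> V" for x y
  proof -
    have "E\<^sup>*\<^sup>* x y" using L that unfolding linked_def by blast
    then show ?thesis by (rule rtranclp_mono[THEN predicate2D, rotated]) (auto simp: join_vertex_def)
  qed
  have 2: "?J v t" "?J t v" using t by (auto simp: join_vertex_def)
  have to_t: "?J\<^sup>*\<^sup>* x t" and of_t: "?J\<^sup>*\<^sup>* t x" if "x \<in> insert v V" for x
    using that 1[OF _ t(2)] 1[OF t(2)] 2 by auto
  show ?thesis
    unfolding linked_def using rtranclp_trans[OF to_t of_t] by blast
qed

lemma realizes_delete_vertex:
  assumes fin: "finite V" and R: "realizes V f E" and v: "v \<in> V" and T: "{y. E v y} = T"
  shows "realizes (V - {v}) (\<lambda>x. f x - of_bool (x \<in> T)) (\<lambda>x y. E x y \<and> x \<noteq> v \<and> y \<noteq> v)"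
proof -
  have "card {y. E x y \<and> x \<noteq> v \<and> y \<noteq> v} = f x - of_bool (x \<in> T)" if x: "x \<in> V - {v}" for x
  proof -
    have "{y. E x y \<and> x \<noteq> v \<and> y \<noteq> v} = {y. E x y} - {v}" using x by auto
    moreover have "v \<in> {y. E x y} \<longleftrightarrow> x \<in> T" using T realizesD(4)[OF R] by blast
    ultimately show ?thesis
      using realizes_finite_nbhd[OF fin R] realizes_card[OF R] x by (auto simp: card_Diff_singleton_if)
  qed
  moreover have "\<forall>x y. E x y \<and> x \<noteq> v \<and> y \<noteq> v \<longrightarrow>
      x \<in> V - {v} \<and> y \<in> V - {v} \<and> x \<noteq> y \<and> E y x \<and> y \<noteq> v \<and> x \<noteq> v"
    using realizesD[OF R] by blast
  ultimately show ?thesis unfolding realizes_def by blast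
qed

section \<open>Edge switching and the Havel-Hakimi reduction\<close>

lemma ex_maximizer:
  fixes f :: "'a \<Rightarrow> 'b::linorder"
  assumes "finite S" "S \<noteq> {}"
  shows "\<exists>m\<in>S. \<forall>x\<in>S. f x \<le> f m"
proof -
  have "Max (f ` S) \<in> f ` S" using assms by simp
  then obtain m where "m \<in> S" "f m = Max (f ` S)" by auto
  then show ?thesis using assms by (intro bexI[of _ m]) auto
qed

lemma ex_top_subset:
  fixes f :: "'a \<Rightarrow> nat"
  assumes "finite W" "k \<le> card W"
  shows "\<exists>T\<subseteq>W. card T = k \<and> (\<forall>t\<in>T. \<forall>u\<in>W - T. f u \<le> f t)"
  using assms(2)
proof (induction k)
  case 0
  then show ?case by (intro exI[of _ "{}"]) auto
next
  case (Suc k)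
  then obtain T where T: "T \<subseteq> W" "card T = k" "\<forall>t\<in>T. \<forall>u\<in>W - T. f u \<le> f t" by auto
  have finT: "finite T" using T(1) assms(1) finite_subset by blast
  have "W - T \<noteq> {}" using T Suc.prems card_mono[OF finT, of W] by fastforce
  then obtain s where s: "s \<in> W - T" "\<forall>u\<in>W - T. f u \<le> f s"
    using ex_maximizer[of "W - T" f] assms(1) by blast
  show ?case
    by (rule exI[of _ "insert s T"]) (use T s finT in auto)
qed

text \<open>Switching: the edges \<open>vs\<close>, \<open>tw\<close> give way to \<open>vt\<close>,
  \<open>sw\<close>. Each of the four vertices loses one neighbour and gains one, so no degree
  changes.\<close>

lemma realizes_exchange:
  assumes fin: "finite V" and R: "realizes V f E" and vs: "E v s" and tw: "E t w"
    and ne: "v \<noteq> t" "v \<noteq> w" "s \<noteq> t" "s \<noteq> w" and vt: "\<not> E v t" and sw: "\<not> E s w"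
  shows "\<exists>E'. realizes V f E' \<and> {y. E' v y} = insert t ({y. E v y} - {s})"
proof -
  define F where "F = {{v, s}, {t, w}}"
  define G where "G = {{v, t}, {s, w}}"
  define E' where "E' x y \<longleftrightarrow> E x y \<and> {x, y} \<notin> F \<or> {x, y} \<in> G" for x y
  note D = realizesD[OF R]
  have mem: "v \<in> V" "s \<in> V" "t \<in> V" "w \<in> V" "v \<noteq> s" "t \<noteq> w"
    using D vs tw by blast+
  note nes = ne ne[symmetric] mem(5,6) mem(5,6)[symmetric]
  have sym: "E s v" "E w t" "\<not> E t v" "\<not> E w s" using D(4) vs tw vt sw by blast+
  note ess = sym vs tw vt sw
  have swap: "card (insert b (N - {a})) = card N" if "finite N" "a \<in> N" "b \<notin> N" for a b :: 'a and N
    using that by (simp add: card_Suc_Diff1 del: card_Diff_insert)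
  have N: "{y. E' v y} = insert t ({y. E v y} - {s})" "{y. E' s y} = insert w ({y. E s y} - {v})"
    "{y. E' t y} = insert v ({y. E t y} - {w})" "{y. E' w y} = insert s ({y. E w y} - {t})"
    unfolding E'_def F_def G_def using nes ess by (auto simp: doubleton_eq_iff)
  have N': "{y. E' x y} = {y. E x y}" if "x \<notin> {v, s, t, w}" for x
    unfolding E'_def F_def G_def using that by (auto simp: doubleton_eq_iff)
  have "card {y. E' x y} = card {y. E x y}" for x
  proof (cases "x \<in> {v, s, t, w}")
    case True
    then show ?thesis
      using N swap[OF realizes_finite_nbhd[OF fin R]] ess by auto
  qed (use N' in simp)
  then have "\<forall>x\<in>V. card {y. E' x y} = f x" using realizes_card[OF R] by simp
  moreover have "x \<in> V \<and> y \<in> V \<and> x \<noteq> y \<and> E' y x" if "E' x y" for x y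
    using that D[of x y] mem nes unfolding E'_def F_def G_def
    by (auto simp: doubleton_eq_iff insert_commute)
  ultimately have "realizes V f E'" unfolding realizes_def by blast
  then show ?thesis using N(1) by blast
qed

text \<open>Havel-Hakimi exchange: while some \<open>t\<close> in \<open>T\<close> is not adjacent
  to \<open>v\<close>, a neighbour \<open>s\<close> of \<open>v\<close> outside \<open>T\<close> is
  traded for it by a switch. The number of vertices of \<open>T\<close> missing from the
  neighbourhood of \<open>v\<close> decreases.\<close>

lemma realizes_with_top_nbhd:
  assumes fin: "finite V" and R: "realizes V f E" and v: "v \<in> V"
    and T: "T \<subseteq> V - {v}" "card T = f v" "\<forall>t\<in>T. \<forall>u\<in>V - {v} - T. f u \<le> f t"
  shows "\<exists>E'. realizes V f E' \<and> {y. E' v y} = T"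
  using R
proof (induction "card (T - {y. E v y})" arbitrary: E rule: less_induct)
  case less
  note R = less.prems
  note D = realizesD[OF R]
  let ?N = "\<lambda>x. {y. E x y}"
  have finN: "finite (?N x)" for x by (rule realizes_finite_nbhd[OF fin R])
  have cN: "card (?N x) = f x" if "x \<in> V" for x by (rule realizes_card[OF R that])
  have finT: "finite T" using T(1) fin finite_subset by blast
  show ?case
  proof (cases "T \<subseteq> ?N v")
    case True
    then have "?N v = T" using card_subset_eq[OF finN True] cN[OF v] T(2) by simp
    then show ?thesis using R by blast
  next
    case False
    then obtain t where t: "t \<in> T" "\<not> E v t" by blast
    have "\<not> ?N v \<subseteq> T"
      using card_subset_eq[OF finT, of "?N v"] cN[OF v] T(2) t by auto
    then obtain s where s: "E v s" "s \<notin> T" by blast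
    have sV: "s \<in> V - {v} - T" and tV: "t \<in> V" and ne: "v \<noteq> t" "s \<noteq> t"
      using s t T(1) D[of v s] by auto
    have le: "f s \<le> f t" using T(3) t(1) sV by blast
    have sv: "E s v" and tv: "\<not> E t v" using D(4) s t by blast+
    \<comment> \<open>Otherwise all neighbours of \<open>t\<close> other than \<open>s\<close> are
      neighbours of \<open>s\<close>, which has \<open>v\<close> in addition. Then \<open>s\<close>
      has larger degree than \<open>t\<close>, against the choice of \<open>T\<close>. If
      \<open>s\<close> and \<open>t\<close> are adjacent, they are first removed from each other's
      neighbourhoods.\<close>
    have "\<exists>w. E t w \<and> \<not> E s w \<and> w \<noteq> s"
    proof (rule ccontr)
      assume "\<not> ?thesis"
      then have sub: "E s w" if "E t w" "w \<noteq> s" for w using that by blast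
      have "card (?N t) < card (?N s)"
      proof (cases "E t s")
        case True
        have "?N t - {s} \<subset> ?N s - {t}"
          using sub sv tv D(3)[of t t] ne by blast
        then have "card (?N t - {s}) < card (?N s - {t})"
          using psubset_card_mono finN by (metis finite_Diff)
        moreover have "t \<in> ?N s" "s \<in> ?N t" using True D(4) by auto
        ultimately show ?thesis using finN by (simp add: card_Diff_singleton)
      next
        case False
        then have "?N t \<subset> ?N s" using sub sv tv by blast
        then show ?thesis using psubset_card_mono finN by metis
      qed
      then show False using cN sV tV le by auto
    qed
    then obtain w where w: "E t w" "\<not> E s w" "w \<noteq> s" by blast
    have "v \<noteq> w" using w tv by blast
    then obtain E' where E': "realizes V f E'" "{y. E' v y} = insert t (?N v - {s})"
      using realizes_exchange[OF fin R s(1) w(1) ne(1) _ ne(2) w(3)[symmetric] t(2) w(2)] by blast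
    have "T - {y. E' v y} \<subset> T - ?N v"
      using E'(2) t s by blast
    then have "card (T - {y. E' v y}) < card (T - ?N v)"
      using psubset_card_mono finT by (metis finite_Diff)
    then show ?thesis using less.hyps E'(1) by blast
  qed
qed

text \<open>Deleting a vertex of minimum degree, after joining it to the vertices of largest degree, keeps
  the degrees positive and the average large, so connectivity is inherited along the induction. The
  disjunct \<open>card V = 1\<close> admits the isolated vertex at the bottom.\<close>

lemma connected_realization_exists:
  assumes "finite V" "V \<noteq> {}" "realizes V f E" "card V = 1 \<or> (\<forall>x\<in>V. 1 \<le> f x)"
    "2 * card V \<le> sum f V + 2"
  shows "\<exists>E. realizes V f E \<and> linked V E"
  using assms
proof (induction "card V" arbitrary: V f E rule: less_induct)
  case less
  note fin = less.prems(1) and R = less.prems(3)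
  show ?case
  proof (cases "card V = 1")
    case True
    then obtain x where "V = {x}" by (auto simp: card_1_singleton_iff)
    then have "linked V E" by (simp add: linked_def)
    then show ?thesis using R by blast
  next
    case False
    then have pos: "1 \<le> f x" if "x \<in> V" for x using less.prems(4) that by blast
    have N2: "2 \<le> card V" using False card_gt_0_iff[of V] less.prems(1,2) by linarith
    define v where "v = arg_min_on f V"
    have v: "v \<in> V" and vmin: "\<And>x. x \<in> V \<Longrightarrow> f v \<le> f x"
      using arg_min_if_finite[OF fin less.prems(2), of f] unfolding v_def by (auto simp: not_less)
    let ?W = "V - {v}"
    have cW: "card ?W = card V - 1" using v fin by simp
    have "f v \<le> card ?W"
      using realizes_card[OF R v] realizes_nbhd_subset[OF R] fin by (metis card_mono finite_Diff)
    then obtain T where T: "T \<subseteq> ?W" "card T = f v" "\<forall>t\<in>T. \<forall>u\<in>?W - T. f u \<le> f t"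
      using ex_top_subset[of ?W "f v" f] fin by auto
    have finT: "finite T" using T(1) fin finite_subset by blast
    obtain E' where E': "realizes V f E'" "{y. E' v y} = T"
      using realizes_with_top_nbhd[OF fin R v T] by blast
    define g where "g x = f x - of_bool (x \<in> T)" for x
    have Rg: "realizes ?W g (\<lambda>x y. E' x y \<and> x \<noteq> v \<and> y \<noteq> v)"
      using realizes_delete_vertex[OF fin E'(1) v E'(2)] unfolding g_def .
    have fg: "f x = g x + of_bool (x \<in> T)" if "x \<in> ?W" for x
      using pos[of x] that by (auto simp: g_def)
    have sumV: "sum f V = f v + sum f ?W" using fin v by (simp add: sum.remove)
    have "sum f ?W = sum g ?W + (\<Sum>x\<in>?W. of_bool (x \<in> T))"
      using fg by (simp add: sum.distrib)
    also have "(\<Sum>x\<in>?W. of_bool (x \<in> T)) = card T"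
      using T(1) fin by (simp add: of_bool_def sum.If_cases Int_absorb1)
    finally have sumg: "sum f V = sum g ?W + 2 * f v" using sumV T(2) by simp
    \<comment> \<open>A vertex dropping to degree 0 had degree 1, so \<open>v\<close> has degree 1
      and \<open>T\<close> is that single vertex. As \<open>T\<close> holds the largest degrees, all
      degrees are 1, and the bound on the sum leaves only two vertices.\<close>
    have "card ?W = 1 \<or> (\<forall>x\<in>?W. 1 \<le> g x)"
    proof (rule ccontr)
      assume *: "\<not> ?thesis"
      then obtain x where x: "x \<in> ?W" "g x = 0" by force
      then have "x \<in> T" "f x = 1" using fg[OF x(1)] pos[of x] by (cases "x \<in> T"; simp)+
      moreover have "f v = 1" using vmin[of x] pos[of v] x v calculation by simp
      ultimately have "T = {x}" using T(2) by (auto simp: card_1_singleton_iff)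
      then have "f u = 1" if "u \<in> V" for u
        using T(3) \<open>f x = 1\<close> \<open>f v = 1\<close> pos[OF that] that x(1) by (cases "u = v \<or> u = x") force+
      then have "sum f V = card V" by simp
      then show False using less.prems(5) N2 cW * by simp
    qed
    \<comment> \<open>Deleting \<open>v\<close> costs \<open>2 * f v\<close>. For
      \<open>f v = 1\<close> this matches the drop of the left side; otherwise
      \<open>sum f V\<close> is at least \<open>card V * f v\<close>, and the claim reduces to
      \<open>f v\<close> being at least 2.\<close>
    moreover have "2 * card ?W \<le> sum g ?W + 2"
    proof (cases "f v = 1")
      case True
      then show ?thesis using sumg less.prems(5) cW N2 by simp
    next
      case False
      have "card V * f v \<le> sum f V" using vmin by (metis mult.commute of_nat_id sum_bounded_below)
      moreover obtain m where m: "card V = m + 2" using N2 by (metis add.commute le_Suc_ex)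
      moreover obtain e where e: "f v = e + 2" using False pos[OF v] le_Suc_ex[of 2 "f v"] by (auto simp: add.commute)
      ultimately show ?thesis using sumg cW by (simp add: algebra_simps)
    qed
    moreover have "?W \<noteq> {}" using cW N2 by (intro notI) simp
    ultimately obtain E1 where E1: "realizes ?W g E1" "linked ?W E1"
      using less.hyps[OF _ _ _ Rg] fin cW N2 by force
    have "T \<noteq> {}" using T(2) pos[OF v] by auto
    moreover have "insert v ?W = V" using v by blast
    ultimately show ?thesis
      using realizes_join_vertex[OF _ E1(1) _ T(1), of v f] linked_join_vertex[OF E1(2) T(1), of v] T(2) fg fin by auto
  qed
qed

lemma card_ge_values:
  assumes "finite S" "\<And>k. k \<in> K \<Longrightarrow> \<exists>u\<in>S. f u = k"
  shows "card K \<le> card S"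
proof -
  have "K \<subseteq> f ` S" using assms(2) by blast
  then show ?thesis using assms(1) by (meson card_image_le card_mono finite_imageI le_trans)
qed

text \<open>Havel-Hakimi: the hypotheses survive the removal of a vertex of maximum degree that is joined
  to the vertices of largest degree.\<close>

lemma realization_if_gap_free:
  fixes f :: "'a \<Rightarrow> nat"
  assumes "finite V" "\<And>v k. v \<in> V \<Longrightarrow> 1 \<le> k \<Longrightarrow> k \<le> f v \<Longrightarrow> \<exists>u\<in>V. f u = k"
    "\<And>v. v \<in> V \<Longrightarrow> 2 * f v \<le> card {u\<in>V. 0 < f u} + 1" "even (sum f V)"
  shows "\<exists>E. realizes V f E"
  using assms
proof (induction "card V" arbitrary: V f rule: less_induct)
  case less
  note fin = less.prems(1) and gap = less.prems(2) and cnt = less.prems(3)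
  show ?case
  proof (cases "\<forall>x\<in>V. f x = 0")
    case True
    then have "realizes V f (\<lambda>_ _. False)" by (simp add: realizes_def)
    then show ?thesis by blast
  next
    case False
    then obtain v where v: "v \<in> V" and vmax: "\<And>x. x \<in> V \<Longrightarrow> f x \<le> f v"
      using ex_maximizer[OF fin, of f] by blast
    define d where "d = f v"
    have d: "1 \<le> d" using False vmax unfolding d_def by fastforce
    have le_d: "f x \<le> d" if "x \<in> V" for x using vmax[OF that] d_def by simp
    let ?W = "V - {v}"
    define P where "P = {u\<in>V. 0 < f u}"
    have finP: "finite P" and vP: "v \<in> P" using fin v d unfolding P_def d_def by auto
    have cP: "2 * d \<le> card P + 1" using cnt[OF v] unfolding P_def d_def .
    \<comment> \<open>For \<open>d = 1\<close> the count alone gives one positive vertex; the even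
      sum provides the second.\<close>
    have cP': "d + 1 \<le> card P"
    proof (cases "d = 1")
      case True
      have "sum f V = sum f P" unfolding P_def by (rule sum.mono_neutral_right) (use fin in auto)
      also have "\<dots> = sum (\<lambda>_. 1) P"
        using le_d True by (intro sum.cong) (force simp: P_def intro: antisym)+
      finally have "even (card P)" using less.prems(4) by simp
      then show ?thesis using cP True by presburger
    qed (use cP d in simp)
    have "P - {v} \<subseteq> ?W" unfolding P_def by auto
    then have "d \<le> card ?W"
      using cP' card_mono[of ?W "P - {v}"] fin finP vP by simp
    then obtain T where T: "T \<subseteq> ?W" "card T = d" "\<And>t u. t \<in> T \<Longrightarrow> u \<in> ?W \<Longrightarrow> u \<notin> T \<Longrightarrow> f u \<le> f t"
      using ex_top_subset[of ?W d f] fin by auto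
    have finT: "finite T" using T(1) fin finite_subset by blast
    have Tpos: "0 < f t" if t: "t \<in> T" for t
    proof (rule ccontr)
      assume "\<not> 0 < f t"
      then have "P - {v} \<subseteq> T - {t}" using T(3)[OF t] unfolding P_def by force
      then have "card (P - {v}) \<le> card (T - {t})" using finT by (meson card_mono finite_Diff)
      then show False using cP' T(2) t finT finP vP d by simp
    qed
    define g where "g x = f x - of_bool (x \<in> T)" for x
    have fg: "f x = g x + of_bool (x \<in> T)" for x
      using Tpos[of x] by (cases "x \<in> T") (auto simp: g_def)
    have gT: "f x = g x + 1" if "x \<in> T" for x using fg[of x] that by simp
    have gN: "f x = g x" if "x \<notin> T" for x using fg[of x] that by simp
    have "\<exists>E. realizes ?W g E"
    proof (rule less.hyps)
      show "card ?W < card V" using v fin by (meson card_Diff1_less)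
      show "finite ?W" using fin by simp
      have "sum f ?W = sum g ?W + (\<Sum>x\<in>?W. of_bool (x \<in> T))"
        using fg by (simp add: sum.distrib)
      also have "(\<Sum>x\<in>?W. of_bool (x \<in> T)) = d"
        using T(1,2) fin by (simp add: of_bool_def sum.If_cases Int_absorb1)
      finally have "sum f V = sum g ?W + 2 * d" using fin v by (simp add: sum.remove d_def)
      then show "even (sum g ?W)" using less.prems(4) by simp
    next
      fix u k assume u: "u \<in> ?W" and k: "1 \<le> k" "k \<le> g u"
      show "\<exists>w\<in>?W. g w = k"
      proof (cases "k = g u")
        case True
        then show ?thesis using u by blast
      next
        case False
        then have k1: "k + 1 \<le> g u" using k by simp
        have gu: "g u \<le> f u" "f u \<le> d" using fg[of u] le_d[of u] u by simp_all
        obtain w0 where w0: "w0 \<in> V" "f w0 = k" using gap[of u k] u k gu by auto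
        obtain w1 where w1: "w1 \<in> V" "f w1 = k + 1" using gap[of u "k + 1"] u k1 gu by auto
        have "w0 \<noteq> v" using w0 k1 gu by (auto simp: d_def)
        show ?thesis
        proof (cases "w0 \<in> T")
          case False
          then show ?thesis using w0 gN \<open>w0 \<noteq> v\<close> by (intro bexI[of _ w0]) auto
        next
          case True
          \<comment> \<open>The candidate \<open>w0\<close> was lowered to \<open>k - 1\<close>.
            Since \<open>T\<close> is a top set, every vertex of larger degree except
            \<open>v\<close> is in \<open>T\<close> too, so \<open>w1\<close> drops from
            \<open>k + 1\<close> to \<open>k\<close> and replaces it.\<close>
          have uT: "u \<in> T" using T(3)[OF True, of u] u w0 k1 gu by fastforce
          have "w1 \<noteq> v" using gT[OF uT] k1 gu w1 by (auto simp: d_def)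
          then have "w1 \<in> T" using T(3)[OF True, of w1] w1 w0 by fastforce
          then show ?thesis using gT w1 \<open>w1 \<noteq> v\<close> by (intro bexI[of _ w1]) auto
        qed
      qed
    next
      fix u assume u: "u \<in> ?W"
      define P' where "P' = {w\<in>?W. 0 < g w}"
      \<comment> \<open>\<open>X\<close> collects the vertices that fall to 0; they and
        \<open>v\<close> are all that the count of positive vertices loses.\<close>
      define X where "X = {t\<in>T. f t = 1}"
      define Y where "Y = {w\<in>?W. 2 \<le> f w}"
      have fins: "finite P'" "finite X" "finite Y" using fin finT unfolding P'_def X_def Y_def by auto
      have gd: "g u \<le> d" using fg[of u] le_d[of u] u by simp
      have "P' = P - {v} - X"
        using T(1) fg by (auto simp: P'_def P_def X_def)
      moreover have "X \<subseteq> P - {v}" using T(1) by (auto simp: P_def X_def)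
      ultimately have cP'eq: "card P' = card P - 1 - card X"
        using finP vP fins by (simp add: card_Diff_subset)
      have "2 * g u \<le> card P' + 1"
      proof (cases "g u \<le> 1")
        case True
        have "1 \<le> card P'" if "g u = 1"
          using that u fins(1) by (auto simp: P'_def Suc_le_eq card_gt_0_iff)
        then show ?thesis using True by (cases "g u = 1") auto
      next
        case False
        then have d2: "2 \<le> d" using gd by simp
        show ?thesis
        proof (cases "X = {}")
          case True
          then have c: "card P' = card P - 1" using cP'eq by simp
          show ?thesis
          proof (cases "g u = d")
            case True
            have uT: "u \<notin> T" using gT[of u] le_d[of u] u True by auto
            have fu: "f u = d" using gN[OF uT] True by simp
            have Td: "f t = d" if "t \<in> T" for t
              using T(3)[OF that u uT] le_d[of t] that T(1) fu by fastforce
            \<comment> \<open>Here \<open>v\<close>, \<open>u\<close> and all of \<open>T\<close>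
              have degree \<open>d\<close>, which makes \<open>d + 2\<close> vertices;
              \<open>Z\<close> adds at least one for each of the degrees \<open>1\<close> to
              \<open>d - 1\<close>.\<close>
            define Z where "Z = {w\<in>V. 1 \<le> f w \<and> f w < d}"
            have "card {1..<d} \<le> card Z"
            proof (rule card_ge_values[where f = f])
              show "finite Z" using fin by (simp add: Z_def)
              show "\<exists>w\<in>Z. f w = k" if "k \<in> {1..<d}" for k
                using gap[OF v, of k] that by (auto simp: Z_def d_def)
            qed
            moreover have "card (insert v (insert u T)) = d + 2"
              using finT T(1,2) u uT by (subst card_insert_disjoint) auto
            moreover have "card (Z \<union> insert v (insert u T)) = card Z + card (insert v (insert u T))"
              using fin finT Td fu by (intro card_Un_disjoint) (auto simp: Z_def d_def)
            moreover have "Z \<union> insert v (insert u T) \<subseteq> P"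
              using T(1) Td u v fu d by (auto simp: Z_def P_def d_def)
            then have "card (Z \<union> insert v (insert u T)) \<le> card P" using finP by (rule card_mono[rotated])
            ultimately show ?thesis using c True d by simp
          qed (use c cP gd in simp)
        next
          case X: False
          \<comment> \<open>Once \<open>T\<close> reaches down to degree 1, it contains all of
            \<open>Y\<close>. Hence \<open>card X = d - card Y\<close>, and a lower bound on
            \<open>card Y\<close> from the gap-free values limits the loss.\<close>
          then have "w \<in> T" if "w \<in> Y" for w
            using T(3) that by (fastforce simp: X_def Y_def)
          then have "T = X \<union> Y" using Tpos T(1) by (fastforce simp: X_def Y_def Suc_le_eq)
          moreover have "X \<inter> Y = {}" by (auto simp: X_def Y_def)
          ultimately have cd: "d = card X + card Y" using T(2) fins by (simp add: card_Un_disjoint)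
          have uY: "u \<in> Y" using False fg[of u] u by (simp add: Y_def)
          have val: "\<exists>w\<in>Y. f w = k" if "2 \<le> k" "k < d" for k
            using gap[OF v, of k] that by (auto simp: Y_def d_def)
          have "card {2..<d} \<le> card Y"
            using val by (intro card_ge_values[OF fins(3)]) auto
          moreover have "card {2..d} \<le> card Y" if "g u = d - 1"
          proof (rule card_ge_values[where f = f, OF fins(3)])
            fix k assume "k \<in> {2..d}"
            moreover have "f u = d" using gT \<open>\<And>w. w \<in> Y \<Longrightarrow> w \<in> T\<close>[OF uY] that d by simp
            ultimately show "\<exists>w\<in>Y. f w = k" using val[of k] uY by (cases "k = d") auto
          qed
          moreover have "g u < d"
            using gT[OF \<open>\<And>w. w \<in> Y \<Longrightarrow> w \<in> T\<close>[OF uY]] le_d[of u] u by simp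
          ultimately show ?thesis using cd cP'eq cP d2 by (cases "g u = d - 1") auto
        qed
      qed
      then show "2 * g u \<le> card {w\<in>?W. 0 < g w} + 1" unfolding P'_def .
    qed
    then obtain E where "realizes ?W g E" by blast
    then have "realizes (insert v ?W) f (join_vertex v T E)"
      using T(1,2) fg fin by (intro realizes_join_vertex) (auto simp: d_def)
    then show ?thesis using v by (auto simp: insert_absorb)
  qed
qed

section \<open>Joining two realizations by a matching\<close>

text \<open>Since \<open>A\<close> and \<open>B\<close> are disjoint and \<open>m\<close> is
  injective, every matched vertex gains exactly one neighbour and only matching edges cross. One
  crossing edge suffices to link the two sides.\<close>

lemma realizes_join_by_matching:
  assumes fin: "finite A" "finite B" and AB: "A \<inter> B = {}"
    and R1: "realizes A g E1" and R2: "realizes B g E2"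
    and S: "S \<subseteq> A" "m ` S \<subseteq> B" "inj_on m S"
    and f: "\<forall>x\<in>A \<union> B. f x = g x + of_bool (x \<in> S \<union> m ` S)"
  defines "E \<equiv> \<lambda>x y. E1 x y \<or> E2 x y \<or> x \<in> S \<and> y = m x \<or> y \<in> S \<and> x = m y"
  shows "realizes (A \<union> B) f E"
    and "{(x, y). x \<in> A \<and> y \<in> B \<and> E x y} = (\<lambda>s. (s, m s)) ` S"
    and "linked A E1 \<Longrightarrow> linked B E2 \<Longrightarrow> S \<noteq> {} \<Longrightarrow> linked (A \<union> B) E"
proof -
  note D1 = realizesD[OF R1] and D2 = realizesD[OF R2]
  have mS: "m s \<in> B" "m s \<notin> A" if "s \<in> S" for s using S(2) AB that by blast+
  have SB: "s \<in> A" "s \<notin> B" if "s \<in> S" for s using S(1) AB that by blast+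
  have nA: "{y. E x y} = {y. E1 x y} \<union> (if x \<in> S then {m x} else {})" if "x \<in> A" for x
    using that D2(1)[of x] AB mS unfolding E_def by auto
  have nB: "{y. E x y} = {y. E2 x y} \<union> {s \<in> S. x = m s}" if "x \<in> B" for x
    using that D1(1)[of x] AB SB unfolding E_def by auto
  have "card {y. E x y} = f x" if x: "x \<in> A \<union> B" for x
  proof (cases "x \<in> A")
    case True
    have "x \<notin> m ` S" using True mS by blast
    moreover have "m x \<notin> {y. E1 x y}" if "x \<in> S" using D1(2)[of x "m x"] mS[OF that] by blast
    ultimately show ?thesis
      unfolding nA[OF True]
      using bspec[OF f x] realizes_card[OF R1 True] realizes_finite_nbhd[OF fin(1) R1, of x] by auto
  next
    case False
    then have xB: "x \<in> B" using x by blast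
    then have xS: "x \<notin> S" using SB by blast
    have disj: "{y. E2 x y} \<inter> {s \<in> S. x = m s} = {}" using D2(2) SB by blast
    have "card {s \<in> S. x = m s} = of_bool (x \<in> m ` S)"
    proof (cases "x \<in> m ` S")
      case True
      then obtain s where "s \<in> S" "x = m s" by blast
      then have "{s \<in> S. x = m s} = {s}" using S(3) by (auto simp: inj_on_def)
      then show ?thesis using True by simp
    next
      case False
      then have "{s \<in> S. x = m s} = {}" by blast
      then show ?thesis using False by (simp only: card.empty) simp
    qed
    moreover have "finite {s \<in> S. x = m s}" using S(1) fin(1) by (simp add: finite_subset)
    ultimately show ?thesis
      unfolding nB[OF xB]
      using bspec[OF f x] realizes_card[OF R2 xB] realizes_finite_nbhd[OF fin(2) R2, of x] disj xS
      by (simp add: card_Un_disjoint)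
  qed
  moreover have "x \<in> A \<union> B \<and> y \<in> A \<union> B \<and> x \<noteq> y \<and> E y x" if "E x y" for x y
  proof -
    have "x \<noteq> m y" if "y \<in> S" "x \<in> S" for x y using mS[OF that(1)] SB[OF that(2)] by blast
    then show ?thesis
      using that D1[of x y] D2[of x y] mS[of x] mS[of y] SB[of x] SB[of y]
      unfolding E_def by auto
  qed
  ultimately show R: "realizes (A \<union> B) f E" unfolding realizes_def by blast
  show "{(x, y). x \<in> A \<and> y \<in> B \<and> E x y} = (\<lambda>s. (s, m s)) ` S"
  proof (intro equalityI subsetI)
    fix p assume "p \<in> {(x, y). x \<in> A \<and> y \<in> B \<and> E x y}"
    then obtain x y where p: "p = (x, y)" "x \<in> A" "y \<in> B" "E x y" by blast
    then have "x \<in> S \<and> y = m x"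
      using D1(2)[of x y] D2(1)[of x y] AB SB(2)[of y] unfolding E_def by blast
    then show "p \<in> (\<lambda>s. (s, m s)) ` S" using p by blast
  qed (use mS SB in \<open>auto simp: E_def\<close>)
  assume L: "linked A E1" "linked B E2" "S \<noteq> {}"
  obtain s where s: "s \<in> S" using L(3) by blast
  have sm: "E s (m s)" "E (m s) s" using s unfolding E_def by blast+
  have le: "E1 \<le> E" "E2 \<le> E" unfolding E_def by auto
  have A: "E\<^sup>*\<^sup>* x y" if "x \<in> A" "y \<in> A" for x y
    using L(1) that rtranclp_mono[OF le(1)] unfolding linked_def by blast
  have B: "E\<^sup>*\<^sup>* x y" if "x \<in> B" "y \<in> B" for x y
    using L(2) that rtranclp_mono[OF le(2)] unfolding linked_def by blast
  have "E\<^sup>*\<^sup>* x s \<and> E\<^sup>*\<^sup>* s x" if "x \<in> A \<union> B" for x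
    using that A[of x s] A[of s x] B[of x "m s"] B[of "m s" x] SB[OF s] mS[OF s] sm
    by (auto intro: rtranclp.rtrancl_into_rtrancl converse_rtranclp_into_rtranclp)
  then show "linked (A \<union> B) E" unfolding linked_def using rtranclp_trans[of E _ s] by blast
qed

section \<open>Splitting the degree sequence\<close>

lemma handshake:
  assumes "simple_graph n E"
  shows "2 * num_edges n E = (\<Sum>i<n. Defs.degree n E i)"
proof -
  define U where "U = {(i, j). i < j \<and> j < n \<and> E i j}"
  have sub: "U \<subseteq> {..<n} \<times> {..<n}" by (auto simp: U_def)
  then have finU: "finite U" by (rule finite_subset) simp
  have "(SIGMA i:{..<n}. {j. j < n \<and> E i j}) = U \<union> prod.swap ` U"
  proof (intro equalityI subsetI)
    fix p assume p: "p \<in> (SIGMA i:{..<n}. {j. j < n \<and> E i j})"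
    obtain i j where ij: "p = (i, j)" by (cases p)
    then have "i < n" "j < n" "E i j" "E j i" "i \<noteq> j"
      using p assms unfolding simple_graph_def by auto
    then have "(i, j) \<in> U \<or> (j, i) \<in> U" by (auto simp: U_def)
    then show "p \<in> U \<union> prod.swap ` U" using ij by force
  qed (use assms in \<open>auto simp: U_def simple_graph_def\<close>)
  moreover have "U \<inter> prod.swap ` U = {}" by (auto simp: U_def)
  ultimately have "card (SIGMA i:{..<n}. {j. j < n \<and> E i j}) = card U + card (prod.swap ` U)"
    using finU by (simp add: card_Un_disjoint)
  also have "card (prod.swap ` U) = card U" by (simp add: card_image)
  finally show ?thesis by (simp add: num_edges_def U_def Defs.degree_def)
qed

lemma sum_le_sum_inj:
  fixes f :: "'a \<Rightarrow> nat"
  assumes "finite T" "inj_on h S" "h ` S \<subseteq> T" "\<And>x. x \<in> S \<Longrightarrow> f x \<le> f (h x)"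
  shows "sum f S \<le> sum f T"
proof -
  have "sum f S \<le> sum f (h ` S)" using assms(2,4) by (simp add: sum.reindex sum_mono)
  also have "\<dots> \<le> sum f T" using assms(1,3) by (intro sum_mono2) auto
  finally show ?thesis .
qed

definition residue_class :: "nat \<Rightarrow> nat \<Rightarrow> nat set" where
  "residue_class n r = {i. i < n \<and> i mod 2 = r}"

lemma finite_residue_class [simp]: "finite (residue_class n r)"
  by (simp add: residue_class_def)

text \<open>Compare each position with its predecessor, which lies in the other class; only position
  0 has none, and it accounts for the term \<open>f 0\<close>. The constant function 1 yields the
  cardinalities.\<close>

lemma alternating_sums:
  fixes f :: "nat \<Rightarrow> nat"
  assumes "\<And>i j. i \<le> j \<Longrightarrow> j < n \<Longrightarrow> f j \<le> f i" "0 < n"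
  shows "sum f (residue_class n 1) \<le> sum f (residue_class n 0)"
    and "sum f (residue_class n 0) \<le> f 0 + sum f (residue_class n 1)"
proof -
  show "sum f (residue_class n 1) \<le> sum f (residue_class n 0)"
  proof (rule sum_le_sum_inj[where h = "\<lambda>i. i - 1"])
    show "inj_on (\<lambda>i. i - 1) (residue_class n 1)"
      by (rule inj_on_diff_nat) (auto simp: residue_class_def)
    show "(\<lambda>i. i - 1) ` residue_class n 1 \<subseteq> residue_class n 0"
      by (auto simp: residue_class_def) presburger
  qed (auto simp: residue_class_def intro: assms)
  have "sum f (residue_class n 0 - {0}) \<le> sum f (residue_class n 1)"
  proof (rule sum_le_sum_inj[where h = "\<lambda>i. i - 1"])
    show "inj_on (\<lambda>i. i - 1) (residue_class n 0 - {0})"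
      by (auto simp: inj_on_def)
    show "(\<lambda>i. i - 1) ` (residue_class n 0 - {0}) \<subseteq> residue_class n 1"
      by (auto simp: residue_class_def) presburger
  qed (auto simp: residue_class_def intro: assms)
  moreover have "sum f (residue_class n 0) = f 0 + sum f (residue_class n 0 - {0})"
    using assms(2) by (intro sum.remove) (auto simp: residue_class_def)
  ultimately show "sum f (residue_class n 0) \<le> f 0 + sum f (residue_class n 1)" by simp
qed

text \<open>Lowering the first \<open>c\<close> degrees of a half leaves room for the \<open>c\<close> edges to the other half; as
  these degrees are maximal, no gap arises.\<close>

lemma half_realization:
  fixes f :: "nat \<Rightarrow> nat"
  assumes mono: "\<And>i j. i \<le> j \<Longrightarrow> j < n \<Longrightarrow> f j \<le> f i"
    and bnd: "\<And>i. i < n \<Longrightarrow> 1 \<le> f i \<and> f i \<le> d"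
    and pair: "\<And>k. 1 \<le> k \<Longrightarrow> k \<le> d \<Longrightarrow> \<exists>i. Suc i < n \<and> f i = k \<and> f (Suc i) = k"
    and d: "3 \<le> d" "4 * d \<le> n" and r: "r < 2" and c: "1 \<le> c" "c \<le> 2"
    and par: "even (sum f (residue_class n r) + c)"
    and big: "2 * card (residue_class n r) \<le> sum f (residue_class n r)"
  shows "\<exists>E. realizes (residue_class n r) (\<lambda>i. f i - of_bool (i < 2 * c)) E \<and> linked (residue_class n r) E"
proof -
  let ?I = "residue_class n r"
  define g where "g i = f i - of_bool (i < 2 * c)" for i
  obtain i where i: "Suc i < n" "f i = d" "f (Suc i) = d" using pair[of d] d by auto
  have f1: "f u = d" if "u < 2" for u
    using mono[of u "Suc i"] bnd[of u] that i by fastforce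
  \<comment> \<open>The adjacent copies of \<open>d - 1\<close> come after the first two positions,
    so the first four positions, which include all lowered ones, have degree at least
    \<open>d - 1\<close>. With \<open>3 <= d\<close> they stay positive.\<close>
  obtain i' where i': "Suc i' < n" "f i' = d - 1" "f (Suc i') = d - 1" using pair[of "d - 1"] d by force
  have "2 \<le> i'" using f1[of i'] i' d by fastforce
  then have f3: "d - 1 \<le> f u" if "u < 4" for u
    using mono[of u "Suc i'"] that i' by fastforce
  have gpos: "1 \<le> g u" if "u \<in> ?I" for u
    using f3[of u] bnd[of u] that d c by (auto simp: g_def residue_class_def)
  have gle: "g u \<le> d" if "u \<in> ?I" for u
    using bnd[of u] that by (auto simp: g_def residue_class_def)
  have inj: "inj (\<lambda>t. 2 * t + r)" by (auto simp: inj_def)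
  have "(\<lambda>t. 2 * t + r) ` {..<2 * d} \<subseteq> ?I" using d r by (auto simp: residue_class_def)
  then have "card ((\<lambda>t. 2 * t + r) ` {..<2 * d}) \<le> card ?I" by (intro card_mono) simp_all
  then have cI: "2 * d \<le> card ?I" using inj by (simp add: card_image inj_on_subset)
  have "?I \<inter> {i. i < 2 * c} = (\<lambda>t. 2 * t + r) ` {..<c}"
  proof (intro equalityI subsetI)
    fix x assume "x \<in> ?I \<inter> {i. i < 2 * c}"
    then have "x = 2 * (x div 2) + r" "x div 2 < c" by (auto simp: residue_class_def)
    then show "x \<in> (\<lambda>t. 2 * t + r) ` {..<c}" by blast
  qed (use c d r in \<open>auto simp: residue_class_def\<close>)
  then have cc: "card (?I \<inter> {i. i < 2 * c}) = c" using inj by (simp add: card_image inj_on_subset)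
  have "sum f ?I = sum g ?I + (\<Sum>i\<in>?I. of_bool (i < 2 * c))"
    unfolding sum.distrib[symmetric] using bnd by (intro sum.cong) (auto simp: g_def residue_class_def)
  also have "(\<Sum>i\<in>?I. of_bool (i < 2 * c)) = c" using cc by (simp add: of_bool_def sum.If_cases)
  finally have sum: "sum f ?I = sum g ?I + c" .
  have "\<exists>E. realizes ?I g E"
  proof (rule realization_if_gap_free)
    show "finite ?I" by simp
    show "even (sum g ?I)" using par unfolding sum by (simp add: add.assoc)
    have "{u \<in> ?I. 0 < g u} = ?I" using gpos by force
    then show "2 * g v \<le> card {u \<in> ?I. 0 < g u} + 1" if "v \<in> ?I" for v
      using cI gle[OF that] by simp
    fix v k assume v: "v \<in> ?I" and k: "1 \<le> k" "k \<le> g v"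
    \<comment> \<open>The value \<open>d - 1\<close> is attained at position \<open>r\<close>,
      lowered from \<open>d\<close>. Smaller values have two adjacent copies, one in each class,
      beyond the lowered positions.\<close>
    consider "k = g v" | "k < g v" "k = d - 1" | "k < d - 1" using k gle[OF v] by linarith
    then show "\<exists>u\<in>?I. g u = k"
    proof cases
      case 1
      then show ?thesis using v by blast
    next
      case 2
      have "r \<in> ?I" using r d by (auto simp: residue_class_def)
      moreover have "g r = k" using f1[OF r] r c 2 by (simp add: g_def)
      ultimately show ?thesis by blast
    next
      case 3
      obtain j where j: "Suc j < n" "f j = k" "f (Suc j) = k" using pair[of k] k 3 by force
      define u where "u = (if j mod 2 = r then j else Suc j)"
      have u: "u \<in> ?I" "f u = k" using j r by (auto simp: u_def residue_class_def mod_Suc)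
      have "4 \<le> u" using f3[of u] u 3 by fastforce
      then have "g u = k" using u c by (simp add: g_def)
      then show ?thesis using u by blast
    qed
  qed
  then obtain E where "realizes ?I g E" by blast
  moreover have "?I \<noteq> {}" using cI d by auto
  ultimately have "\<exists>E. realizes ?I g E \<and> linked ?I E"
    using gpos big sum c by (intro connected_realization_exists) auto
  then show ?thesis unfolding g_def .
qed

text \<open>In a monotone list all entries between two equal ones agree with them. Adjacent
  positions matter because they have opposite parity, so both halves receive the value.\<close>

lemma sorted_adjacent_duplicate:
  assumes "sorted_wrt (\<ge>) ds" "1 < count (mset ds) (k :: nat)"
  shows "\<exists>i. Suc i < length ds \<and> ds ! i = k \<and> ds ! Suc i = k"
proof -
  let ?S = "{i. i < length ds \<and> ds ! i = k}"
  have "card ?S = count (mset ds) k"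
    by (simp add: count_mset count_list_eq_length_filter length_filter_conv_card eq_commute)
  then have "\<not> card ?S \<le> Suc 0" using assms(2) by simp
  then obtain i j where "i \<in> ?S" "j \<in> ?S" "i \<noteq> j"
    by (subst (asm) card_le_Suc0_iff_eq) auto
  then have "\<exists>i j. i < j \<and> j < length ds \<and> ds ! i = k \<and> ds ! j = k"
    by (cases i j rule: linorder_cases) auto
  then obtain i j where ij: "i < j" "j < length ds" "ds ! i = k" "ds ! j = k" by blast
  have "ds ! y \<le> ds ! x" if "x \<le> y" "y < length ds" for x y
    using assms(1) that by (cases "x = y") (auto simp: sorted_wrt_iff_nth_less)
  from this[of i "Suc i"] this[of "Suc i" j] show ?thesis
    using ij by (intro exI[of _ i]) auto
qed

section \<open>Assembling the graph and estimating its gap\<close>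

theorem theorem3:
  fixes ds :: "nat list" and n dmax :: nat
  assumes "ds \<noteq> []"
    and "n = length ds"
    and "dmax = Max (set ds)"
    and "sorted_wrt (\<ge>) ds"
    and "full_sequence ds"
    and "graphic ds"
    and "\<forall>d \<in> set ds. 1 \<le> d \<and> d \<le> dmax"
    and "real dmax \<le> real n / 4"
    and "sum_list ds \<ge> 2 * n + dmax"
    and "\<forall>k. 1 \<le> k \<and> k \<le> dmax \<longrightarrow> count (mset ds) k > 1"
  shows "\<exists>E. realization ds E \<and> connected_graph n E \<and>
           spectral_gap n E \<le> 4 / (real (num_edges n E) - real dmax / 2)"
proof -
  define f where "f i = ds ! i" for i
  have n0: "0 < n" using assms(1,2) by simp
  have mono: "f j \<le> f i" if "i \<le> j" "j < n" for i j
    using assms(2,4) that by (cases "i = j") (auto simp: f_def sorted_wrt_iff_nth_less)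
  have bnd: "1 \<le> f i \<and> f i \<le> dmax" if "i < n" for i
    using assms(2,7) that by (simp add: f_def)
  have pair: "\<exists>i. Suc i < n \<and> f i = k \<and> f (Suc i) = k" if "1 \<le> k" "k \<le> dmax" for k
    using sorted_adjacent_duplicate[OF assms(4)] assms(2,10) that by (simp add: f_def)
  let ?A = "residue_class n 0" and ?B = "residue_class n 1"
  have AB: "?A \<union> ?B = {..<n}" "?A \<inter> ?B = {}" by (auto simp: residue_class_def)
  have split: "sum h {..<n} = sum h ?A + sum h ?B" for h :: "nat \<Rightarrow> nat"
    unfolding AB(1)[symmetric] using AB(2) by (simp add: sum.union_disjoint)
  have tot: "sum_list ds = sum f {..<n}"
    by (simp add: sum_list_sum_nth assms(2) f_def lessThan_atLeast0)
  have "sum f {..<n} \<le> n * dmax" using bnd sum_bounded_above[of "{..<n}" f dmax] by simp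
  \<comment> \<open>With \<open>dmax\<close> at most 2 the sum would be at most
    \<open>2 * n\<close>, below the assumed bound.\<close>
  have d3: "3 \<le> dmax"
  proof (rule ccontr)
    assume "\<not> 3 \<le> dmax"
    then have "n * dmax \<le> n * 2" by simp
    moreover have "1 \<le> dmax" using bnd[OF n0] by simp
    ultimately show False using \<open>sum f {..<n} \<le> n * dmax\<close> assms(9) tot by linarith
  qed
  have n4: "4 * dmax \<le> n" using assms(8) by linarith
  have BA: "sum f ?B \<le> sum f ?A" "sum f ?A \<le> f 0 + sum f ?B"
    using alternating_sums[of n f] mono n0 by auto
  have AB': "sum f ?A \<le> sum f ?B + dmax" using BA(2) bnd[OF n0] by simp
  have cards: "card ?B \<le> card ?A" "card ?A \<le> 1 + card ?B" "card ?A + card ?B = n"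
    using alternating_sums[of n "\<lambda>_. 1"] n0 split[of "\<lambda>_. 1"] by auto
  have sums: "2 * n + dmax \<le> sum f ?A + sum f ?B" using assms(9) tot split[of f] by simp
  define c :: nat where "c = (if even (sum f ?A) then 2 else 1)"
  have c: "1 \<le> c" "c \<le> 2" "even (sum f ?A + c)" by (auto simp: c_def)
  have "even (sum f ?A + sum f ?B)" using assms(5) tot split[of f] by (simp add: full_sequence_def)
  then have cB: "even (sum f ?B + c)" using c(3) by presburger
  define g where "g i = f i - of_bool (i < 2 * c)" for i
  \<comment> \<open>The sum over \<open>?A\<close> is at least \<open>n + dmax / 2\<close> and that
    over \<open>?B\<close> at least \<open>n\<close>, while the cardinalities are at most
    \<open>(n + 1) / 2\<close> and \<open>n / 2\<close>; this gives the average degree 2 needed in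
    each half.\<close>
  obtain E1 where E1: "realizes ?A g E1" "linked ?A E1"
    using half_realization[OF mono bnd pair d3 n4 _ c(1,2) c(3)] sums AB' BA cards d3
    unfolding g_def by force
  obtain E2 where E2: "realizes ?B g E2" "linked ?B E2"
    using half_realization[OF mono bnd pair d3 n4 _ c(1,2) cB] sums AB' BA cards d3
    unfolding g_def by force
  \<comment> \<open>The first \<open>c\<close> even positions, each matched with the odd position
    after it; together they are exactly the lowered positions.\<close>
  define S where "S = (\<lambda>t. 2 * t) ` {..<c}"
  have SA: "S \<subseteq> ?A" "Suc ` S \<subseteq> ?B" "inj_on Suc S" "card S = c"
    using c d3 n4 by (auto simp: S_def residue_class_def card_image inj_on_def)
  have S0: "S \<noteq> {}" using SA(4) c(1) by auto
  have memS: "x \<in> S \<union> Suc ` S \<longleftrightarrow> x < 2 * c" for x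
  proof
    assume "x < 2 * c"
    then have "x = 2 * (x div 2) \<or> x = Suc (2 * (x div 2))" "x div 2 < c" by presburger+
    then show "x \<in> S \<union> Suc ` S" unfolding S_def by blast
  qed (auto simp: S_def)
  have fg: "\<forall>x\<in>?A \<union> ?B. f x = g x + of_bool (x \<in> S \<union> Suc ` S)"
    using bnd unfolding memS g_def AB(1) by auto
  define E where "E x y \<longleftrightarrow> E1 x y \<or> E2 x y \<or> x \<in> S \<and> y = Suc x \<or> y \<in> S \<and> x = Suc y" for x y
  note join = realizes_join_by_matching[OF finite_residue_class finite_residue_class AB(2) E1(1) E2(1)
      SA(1-3) fg, folded E_def]
  have R: "realizes {..<n} f E" using join(1) AB(1) by simp
  have L: "linked {..<n} E" using join(3)[OF E1(2) E2(2) S0] AB(1) by simp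
  have "{(x, y). x \<in> ?A \<and> y \<in> ?B \<and> E x y} = (\<lambda>s. (s, Suc s)) ` S" by (rule join(2))
  then have cut: "card {(x, y). x \<in> ?A \<and> y \<in> ?B \<and> E x y} = c"
    using SA(4) by (simp add: card_image inj_on_def)
  note D = realizesD[OF R]
  have simple: "simple_graph n E" unfolding simple_graph_def using D by blast
  have deg: "Defs.degree n E i = f i" if "i < n" for i
  proof -
    have "{j. j < n \<and> E i j} = {j. E i j}" using D(2) by blast
    then show ?thesis using realizes_card[OF R, of i] that by (simp add: Defs.degree_def)
  qed
  have real: "realization ds E" using simple deg by (simp add: realization_def assms(2) f_def)
  have conn: "connected_graph n E"
  proof -
    have "{(a, b). a < n \<and> b < n \<and> E a b} = {(a, b). E a b}" using D(1,2) by blast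
    then show ?thesis
      using L unfolding connected_graph_def linked_def
      by (simp add: rtranclp_rtrancl_eq[symmetric])
  qed
  let ?m = "num_edges n E"
  have m: "2 * ?m = sum f ?A + sum f ?B" using handshake[OF simple] deg split[of f] by simp
  define a b where "a = real (sum f ?A)" and "b = real (sum f ?B)"
  have "sum (Defs.degree n E) ?A = sum f ?A" "sum (Defs.degree n E) ?B = sum f ?B"
    using deg AB(1) by (auto intro!: sum.cong)
  moreover have "?A \<noteq> {}" "?B \<noteq> {}" using n4 d3 cards by auto
  ultimately have gap: "spectral_gap n E \<le> real c * (1 / a + 1 / b)"
    using spectral_gap_le_cut[OF simple conn _ AB] deg bnd cut unfolding a_def b_def by force
  have ab: "a + b = 2 * real ?m" "real ?m \<le> a" "real ?m - real dmax / 2 \<le> b"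
    using m BA AB' unfolding a_def b_def by linarith+
  have mpos: "0 < real ?m - real dmax / 2" using m sums n0 by linarith
  have pos: "0 < a" "0 < b" "0 < real ?m" using ab mpos by linarith+
  \<comment> \<open>Since \<open>a + b\<close> is twice the number of edges, the fraction sum is
    \<open>2 * ?m / (a * b)\<close>, and the factors of \<open>a * b\<close> are bounded below
    separately.\<close>
  have "real c * (1 / a + 1 / b) \<le> 2 * (1 / a + 1 / b)"
    using c pos by (intro mult_right_mono) auto
  also have "\<dots> = 4 * real ?m / (a * b)" using pos ab(1) by (simp add: field_simps)
  also have "\<dots> \<le> 4 * real ?m / (real ?m * (real ?m - real dmax / 2))"
    using pos mpos ab by (intro divide_left_mono mult_mono mult_pos_pos) auto
  also have "\<dots> = 4 / (real ?m - real dmax / 2)" using pos by simp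
  finally show ?thesis using real conn gap by (intro exI[of _ E]) auto
qed

end
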